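(* Let $S:\operatorname{dom} S\subseteq \ell^2\to\ell^2$ be the linear operator with $$\operatorname{dom} S=\Big\{y=(y_n)_{n\ge 1}\in\ell^2 \;\Big|\; \sum_{i\ge 1}y_i=0,\ \Big(\sum_{i\le n}y_i\Big)_{n\ge 1}\in\ell^2\Big\},\qquad Sy=\Big(\sum_{i<n}y_i+\tfrac12 y_n\Big)_{n\ge 1}\quad (y\in\operatorname{dom} S).$$ Then $$S^*y=\Big(\sum_{i>n}y_i+\tfrac12 y_n\Big)_{n\ge 1}\quad\text{for all } y=(y_n)\in\operatorname{dom}S^*,$$ where $$\operatorname{dom}S^*=\Big\{y=(y_n)\in\ell^2\;\Big|\;\sum_{i\ge 1}y_i\in\mathbb{R},\ \Big(\sum_{i>n}y_i\Big)_{n\ge 1}\in\ell^2\Big\}.$$ (In matrix form, $S^*$ is the infinite matrix with entries $\tfrac12$ on the diagonal, $1$ above the diagonal and $0$ below it.) Moreover, $\operatorname{dom}S\subsetneqq\operatorname{dom}S^*$, $S^*=-S$ on $\operatorname{dom}S$, and $S^*$ is not skew.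
   Context: $\ell^2$ is the real Hilbert space of square-summable real sequences $(x_1,x_2,\dots)$ with inner product $\langle\cdot,\cdot\rangle$. Infinite series are limits of partial sums; the condition $\sum_{i\ge1}y_i\in\mathbb{R}$ means that the series converges. By convention $\sum_{i<1}y_i=0$. For a real Hilbert space $X$, a linear relation is a set-valued operator $A:X\rightrightarrows X$ whose graph $\operatorname{gra}A=\{(x,x^* )\in X\times X\mid x^*\in Ax\}$ is a linear subspace; a linear single-valued operator with domain $\operatorname{dom}S$ is identified with the at most single-valued linear relation having the same graph, and an at most single-valued linear relation is identified with the corresponding linear operator. The adjoint $A^*$ is defined by $\operatorname{gra}A^*=\{(x,x^* )\mid (x^*,-x)\in(\operatorname{gra}A)^\perp\}$, and $\operatorname{dom}A=\{x\mid Ax\ne\varnothing\}$. A linear relation $A$ is skew if $\langle x,x^*\rangle=0$ for all $(x,x^* )\in\operatorname{gra}A$. *)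

theory Defs
  imports "HOL-Analysis.Analysis"
begin

section \<open>The real Hilbert space of square-summable sequences\<close>

definition square_summable :: "(nat \<Rightarrow> real) \<Rightarrow> bool" where
  "square_summable x \<longleftrightarrow> summable (\<lambda>n. (x n)\<^sup>2)"

lemma square_summable_zero: "square_summable (\<lambda>n. 0)"
  by (simp add: square_summable_def)

lemma square_summable_scale: "square_summable x \<Longrightarrow> square_summable (\<lambda>n. c * x n)"
  by (simp add: square_summable_def power_mult_distrib summable_mult)

lemma square_summable_mult:
  assumes "square_summable x" "square_summable y"
  shows "summable (\<lambda>n. x n * y n)"
proof (rule summable_comparison_test')
  show "summable (\<lambda>n. (x n)\<^sup>2 + (y n)\<^sup>2)"
    using assms by (auto simp: square_summable_def intro: summable_add)
  fix n :: nat
  have "2 * (\<bar>x n\<bar> * \<bar>y n\<bar>) \<le> (x n)\<^sup>2 + (y n)\<^sup>2"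
    using sum_squares_bound [of "\<bar>x n\<bar>" "\<bar>y n\<bar>"] by simp
  moreover have "0 \<le> \<bar>x n\<bar> * \<bar>y n\<bar>" by simp
  ultimately show "norm (x n * y n) \<le> (x n)\<^sup>2 + (y n)\<^sup>2"
    unfolding real_norm_def abs_mult by linarith
qed

lemma square_summable_add:
  assumes "square_summable x" "square_summable y"
  shows "square_summable (\<lambda>n. x n + y n)"
proof -
  have "summable (\<lambda>n. (x n)\<^sup>2 + (y n)\<^sup>2 + 2 * (x n * y n))"
    using assms square_summable_mult [OF assms]
    by (intro summable_add summable_mult) (simp_all add: square_summable_def)
  then show ?thesis
    by (simp add: square_summable_def power2_sum algebra_simps)
qed

text \<open>
  The coordinates are numbered from \<open>0\<close>: the \<open>n\<close>-th term of a sequence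
  \<open>(x\<^sub>1, x\<^sub>2, \<dots>)\<close> is \<open>coord x (n - 1)\<close>.
\<close>

typedef ell2 = "{x. square_summable x}"
  morphisms coord Abs_ell2
  using square_summable_zero by blast

setup_lifting type_definition_ell2

lemma square_summable_coord: "square_summable (coord x)"
  using coord by simp

lemma ell2_eqI: "(\<And>n. coord x n = coord y n) \<Longrightarrow> x = y"
  by (simp add: coord_inject [symmetric] fun_eq_iff)

instantiation ell2 :: real_vector
begin

lift_definition zero_ell2 :: ell2 is "\<lambda>n. 0"
  by (rule square_summable_zero)

lift_definition plus_ell2 :: "ell2 \<Rightarrow> ell2 \<Rightarrow> ell2" is "\<lambda>x y n. x n + y n"
  by (rule square_summable_add)

lift_definition scaleR_ell2 :: "real \<Rightarrow> ell2 \<Rightarrow> ell2" is "\<lambda>c x n. c * x n"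
  by (rule square_summable_scale)

lift_definition uminus_ell2 :: "ell2 \<Rightarrow> ell2" is "\<lambda>x n. - x n"
  by (simp add: square_summable_def)

lift_definition minus_ell2 :: "ell2 \<Rightarrow> ell2 \<Rightarrow> ell2" is "\<lambda>x y n. x n - y n"
  using square_summable_add [OF _ square_summable_scale [where c="-1"]] by simp

instance
  by standard
    (auto intro!: ell2_eqI simp: minus_ell2.rep_eq zero_ell2.rep_eq plus_ell2.rep_eq
      uminus_ell2.rep_eq scaleR_ell2.rep_eq algebra_simps)

end

instantiation ell2 :: real_inner
begin

definition inner_ell2 :: "ell2 \<Rightarrow> ell2 \<Rightarrow> real" where
  "inner_ell2 x y = (\<Sum>n. coord x n * coord y n)"

definition norm_ell2 :: "ell2 \<Rightarrow> real" where
  "norm_ell2 x = sqrt (x \<bullet> x)"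

definition dist_ell2 :: "ell2 \<Rightarrow> ell2 \<Rightarrow> real" where
  "dist_ell2 x y = norm (x - y)"

definition sgn_ell2 :: "ell2 \<Rightarrow> ell2" where
  "sgn_ell2 x = x /\<^sub>R norm x"

definition uniformity_ell2 :: "(ell2 \<times> ell2) filter" where
  "uniformity_ell2 = (INF e\<in>{0<..}. principal {(x, y). dist x y < e})"

definition open_ell2 :: "ell2 set \<Rightarrow> bool" where
  "open_ell2 U \<longleftrightarrow> (\<forall>x\<in>U. \<forall>\<^sub>F (x', y) in uniformity. x' = x \<longrightarrow> y \<in> U)"

instance
proof
  fix x y z :: ell2 and a :: real
  have s: "summable (\<lambda>n. coord u n * coord v n)" for u v
    by (rule square_summable_mult) (rule square_summable_coord)+
  show "dist x y = norm (x - y)" by (rule dist_ell2_def)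
  show "sgn x = x /\<^sub>R norm x" by (rule sgn_ell2_def)
  show "(uniformity :: (ell2 \<times> ell2) filter) = (INF e\<in>{0<..}. principal {(x, y). dist x y < e})"
    by (rule uniformity_ell2_def)
  show "open U = (\<forall>x\<in>U. \<forall>\<^sub>F (x', y) in uniformity. x' = x \<longrightarrow> y \<in> U)" for U :: "ell2 set"
    by (rule open_ell2_def)
  show "norm x = sqrt (x \<bullet> x)" by (rule norm_ell2_def)
  show "x \<bullet> y = y \<bullet> x" by (simp add: inner_ell2_def mult.commute)
  show "(x + y) \<bullet> z = x \<bullet> z + y \<bullet> z"
    by (simp add: inner_ell2_def plus_ell2.rep_eq distrib_right suminf_add [OF s s])
  show "(a *\<^sub>R x) \<bullet> y = a * (x \<bullet> y)"
    by (simp add: inner_ell2_def scaleR_ell2.rep_eq mult.assoc suminf_mult [OF s])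
  show "0 \<le> x \<bullet> x"
    by (simp add: inner_ell2_def suminf_nonneg [OF s])
  show "x \<bullet> x = 0 \<longleftrightarrow> x = 0"
  proof
    assume "x \<bullet> x = 0"
    then have "\<forall>n. coord x n * coord x n = 0"
      using suminf_eq_zero_iff [OF s [of x x]] by (simp add: inner_ell2_def)
    then show "x = 0"
      by (intro ell2_eqI) (simp add: zero_ell2.rep_eq)
  next
    assume "x = 0" then show "x \<bullet> x = 0"
      by (simp add: inner_ell2_def zero_ell2.rep_eq)
  qed
qed

end

lemma coord_diff: "coord (x - y) n = coord x n - coord y n"
  by (simp add: minus_ell2.rep_eq)

lemma norm_ell2_square: "(norm x)\<^sup>2 = (\<Sum>n. (coord x n)\<^sup>2)"
  by (simp only: power2_norm_eq_inner inner_ell2_def) (simp add: power2_eq_square)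

lemma sum_coord_le_norm: "(\<Sum>n<N. (coord x n)\<^sup>2) \<le> (norm x)\<^sup>2"
  unfolding norm_ell2_square
  by (rule sum_le_suminf) (use square_summable_coord in \<open>auto simp: square_summable_def\<close>)

lemma coord_le_norm: "\<bar>coord x n\<bar> \<le> norm x"
proof (rule power2_le_imp_le)
  have "(coord x n)\<^sup>2 \<le> (\<Sum>i<Suc n. (coord x i)\<^sup>2)"
    by (rule member_le_sum) auto
  then show "\<bar>coord x n\<bar>\<^sup>2 \<le> (norm x)\<^sup>2"
    using sum_coord_le_norm [where N="Suc n" and x=x] by (simp del: sum.lessThan_Suc)
qed simp

instance ell2 :: complete_space
proof
  fix X :: "nat \<Rightarrow> ell2"
  assume X: "Cauchy X"
  have "Cauchy (\<lambda>k. coord (X k) n)" for n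
    unfolding Cauchy_def
  proof (intro allI impI)
    fix e :: real assume "0 < e"
    then obtain M where "\<forall>j\<ge>M. \<forall>k\<ge>M. dist (X j) (X k) < e"
      using X unfolding Cauchy_def by blast
    then show "\<exists>M. \<forall>j\<ge>M. \<forall>k\<ge>M. dist (coord (X j) n) (coord (X k) n) < e"
      by (metis coord_diff coord_le_norm dist_norm order_le_less_trans real_norm_def)
  qed
  then have "\<forall>n. \<exists>l. (\<lambda>k. coord (X k) n) \<longlonglongrightarrow> l"
    using Cauchy_convergent_iff convergent_def by blast
  then obtain l where l: "\<And>n. (\<lambda>k. coord (X k) n) \<longlonglongrightarrow> l n"
    by metis
  have tail: "\<exists>M. \<forall>j\<ge>M. \<forall>N. (\<Sum>n<N. (coord (X j) n - l n)\<^sup>2) \<le> e\<^sup>2" if "0 < e" for e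
  proof -
    obtain M where M: "\<And>j k. j \<ge> M \<Longrightarrow> k \<ge> M \<Longrightarrow> dist (X j) (X k) < e"
      using X \<open>0 < e\<close> unfolding Cauchy_def by blast
    have "(\<Sum>n<N. (coord (X j) n - l n)\<^sup>2) \<le> e\<^sup>2" if "j \<ge> M" for j N
    proof (rule LIMSEQ_le_const2)
      show "(\<lambda>k. \<Sum>n<N. (coord (X j) n - coord (X k) n)\<^sup>2)
          \<longlonglongrightarrow> (\<Sum>n<N. (coord (X j) n - l n)\<^sup>2)"
        by (intro tendsto_intros l)
      have "(\<Sum>n<N. (coord (X j) n - coord (X k) n)\<^sup>2) \<le> e\<^sup>2" if "k \<ge> M" for k
      proof -
        have "(\<Sum>n<N. (coord (X j) n - coord (X k) n)\<^sup>2) \<le> (norm (X j - X k))\<^sup>2"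
          using sum_coord_le_norm [of "X j - X k" N] by (simp add: coord_diff)
        also have "\<dots> \<le> e\<^sup>2"
          using M [OF \<open>j \<ge> M\<close> that] by (intro power_mono) (simp_all add: dist_norm)
        finally show ?thesis .
      qed
      then show "\<exists>K. \<forall>k\<ge>K. (\<Sum>n<N. (coord (X j) n - coord (X k) n)\<^sup>2) \<le> e\<^sup>2" by blast
    qed
    then show ?thesis by blast
  qed
  obtain M where M: "\<And>N. (\<Sum>n<N. (coord (X M) n - l n)\<^sup>2) \<le> 1"
    using tail [of 1] by auto
  have d: "square_summable (\<lambda>n. coord (X M) n - l n)"
    unfolding square_summable_def by (rule summableI_nonneg_bounded [OF _ M]) simp
  have "square_summable (\<lambda>n. coord (X M) n + (-1) * (coord (X M) n - l n))"
    by (rule square_summable_add [OF square_summable_coord square_summable_scale [OF d]])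
  then have L: "coord (Abs_ell2 l) = l"
    by (intro Abs_ell2_inverse) simp
  have "X \<longlonglongrightarrow> Abs_ell2 l"
  proof (rule metric_LIMSEQ_I)
    fix e :: real assume "0 < e"
    then obtain K where K: "\<And>j N. j \<ge> K \<Longrightarrow> (\<Sum>n<N. (coord (X j) n - l n)\<^sup>2) \<le> (e/2)\<^sup>2"
      using tail [of "e/2"] by auto
    have "dist (X j) (Abs_ell2 l) < e" if "j \<ge> K" for j
    proof -
      have "summable (\<lambda>n. (coord (X j - Abs_ell2 l) n)\<^sup>2)"
        using square_summable_coord by (simp add: square_summable_def)
      then have "(norm (X j - Abs_ell2 l))\<^sup>2 \<le> (e/2)\<^sup>2"
        unfolding norm_ell2_square
        by (rule suminf_le_const) (simp add: coord_diff L K [OF that])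
      then have "norm (X j - Abs_ell2 l) \<le> e/2"
        by (rule power2_le_imp_le) (use \<open>0 < e\<close> in simp)
      then show ?thesis using \<open>0 < e\<close> by (simp add: dist_norm)
    qed
    then show "\<exists>K. \<forall>j\<ge>K. dist (X j) (Abs_ell2 l) < e" by blast
  qed
  then show "convergent X" by (auto simp: convergent_def)
qed

section \<open>Linear relations\<close>

text \<open>
  A set-valued operator is represented by its graph, so that its domain is \<^const>\<open>Domain\<close>
  and the set of its values at \<open>x\<close> is the relational image \<open>A `` {x}\<close>.
\<close>

definition linear_relation :: "('a::real_inner \<times> 'a) set \<Rightarrow> bool" where
  "linear_relation A \<longleftrightarrow> subspace A"

definition adjoint_relation :: "('a::real_inner \<times> 'a) set \<Rightarrow> ('a \<times> 'a) set" where
  "adjoint_relation A = {(x, x'). (x', - x) \<in> A\<^sup>\<bottom>}"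

definition skew_relation :: "('a::real_inner \<times> 'a) set \<Rightarrow> bool" where
  "skew_relation A \<longleftrightarrow> (\<forall>(x, x') \<in> A. x \<bullet> x' = 0)"

lemma linear_relation_adjoint: "linear_relation (adjoint_relation A)"
proof -
  have *: "(x, x') \<in> adjoint_relation A \<longleftrightarrow> (\<forall>(a, a') \<in> A. a \<bullet> x' = a' \<bullet> x)" for x x'
    by (auto simp: adjoint_relation_def orthogonal_comp_def orthogonal_def)
  show ?thesis
    by (auto simp: linear_relation_def subspace_def * zero_prod_def inner_add_right
        split: prod.splits)
qed

section \<open>The operator\<close>

definition dom_S :: "ell2 set" where
  "dom_S = {y. coord y sums 0 \<and> square_summable (\<lambda>n. \<Sum>i\<le>n. coord y i)}"

definition S :: "(ell2 \<times> ell2) set" where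
  "S = {(y, z). y \<in> dom_S \<and> (\<forall>n. coord z n = (\<Sum>i<n. coord y i) + coord y n / 2)}"

lemma Domain_S: "Domain S = dom_S"
proof
  show "dom_S \<subseteq> Domain S"
  proof
    fix y assume y: "y \<in> dom_S"
    have "square_summable (\<lambda>n. (\<Sum>i\<le>n. coord y i) + (- 1 / 2) * coord y n)"
      using y by (intro square_summable_add square_summable_scale square_summable_coord)
        (simp add: dom_S_def)
    then have "square_summable (\<lambda>n. (\<Sum>i<n. coord y i) + coord y n / 2)"
      by (simp add: lessThan_Suc_atMost [symmetric] add.commute)
    then have "(y, Abs_ell2 (\<lambda>n. (\<Sum>i<n. coord y i) + coord y n / 2)) \<in> S"
      using y by (simp add: S_def Abs_ell2_inverse)
    then show "y \<in> Domain S" by blast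
  qed
qed (auto simp: S_def)

lemma single_valued_S: "single_valued S"
  by (auto simp: single_valued_def S_def intro!: ell2_eqI)

lemma linear_relation_S: "linear_relation S"
proof -
  have "0 \<in> dom_S"
    by (simp add: dom_S_def zero_ell2.rep_eq square_summable_zero)
  moreover have "x + y \<in> dom_S" if "x \<in> dom_S" "y \<in> dom_S" for x y
    using that sums_add [of "coord x" 0 "coord y" 0]
    by (auto simp: dom_S_def plus_ell2.rep_eq sum.distrib square_summable_add)
  moreover have "c *\<^sub>R x \<in> dom_S" if "x \<in> dom_S" for x c
    using that sums_mult [of "coord x" 0 c]
    by (auto simp: dom_S_def scaleR_ell2.rep_eq sum_distrib_left [symmetric]
        square_summable_scale)
  ultimately show ?thesis
    by (auto simp: linear_relation_def subspace_def S_def zero_prod_def zero_ell2.rep_eq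
        plus_ell2.rep_eq scaleR_ell2.rep_eq sum.distrib sum_distrib_left [symmetric]
        algebra_simps)
qed

end

theory Submission
  imports Defs
begin

text \<open>
  Everything follows from one description of the graph of the adjoint: \<open>(x, x')\<close> belongs to it
  exactly when \<open>\<Sum>\<^sub>i x\<^sub>i\<close> converges and \<open>x'\<^sub>n\<close> is \<open>\<Sum>\<^bsub>i>n\<^esub> x\<^sub>i + x\<^sub>n / 2\<close>
  (\<open>adjoint_S_iff\<close>). The square-summability of the tails is implicit here, since
  \<open>x\<close> and \<open>x'\<close> are both square-summable.

  One inclusion needs only finitely supported test vectors. The differences
  \<open>e\<^sub>n - e\<^bsub>n+1\<^esub>\<close> of consecutive unit vectors lie in the domain, and \<open>S\<close> sends them to
  \<open>(e\<^sub>n + e\<^bsub>n+1\<^esub>) / 2\<close>. Testing \<open>(x, x')\<close> against them shows that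
  \<open>t\<^sub>n = x'\<^sub>n - x\<^sub>n / 2\<close> satisfies \<open>t\<^sub>n - t\<^bsub>n+1\<^esub> = x\<^bsub>n+1\<^esub>\<close>, and since \<open>t\<close> is
  square-summable it tends to \<open>0\<close>, so that \<open>t\<^sub>n\<close> is the tail \<open>\<Sum>\<^bsub>i>n\<^esub> x\<^sub>i\<close>.

  The other inclusion is summation by parts. With the heads \<open>p\<^sub>n = \<Sum>\<^bsub>i<n\<^esub> a\<^sub>i\<close> of
  \<open>a \<in> dom_S\<close> and the tails \<open>r\<^sub>n = \<Sum>\<^bsub>i\<ge>n\<^esub> x\<^sub>i\<close>, the \<open>n\<close>-th term of
  \<open>\<langle>a, x'\<rangle> - \<langle>S a, x\<rangle>\<close> is \<open>p\<^bsub>n+1\<^esub> r\<^bsub>n+1\<^esub> - p\<^sub>n r\<^sub>n\<close>. This telescopes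
  to \<open>0\<close>, because \<open>p\<^sub>0 = 0\<close> and both \<open>p\<close> and \<open>r\<close> tend to \<open>0\<close>.

  On \<open>dom_S\<close> the total is \<open>0\<close>, so tails are negatives of heads and the adjoint is \<open>- S\<close>.
  The first unit vector has total \<open>1\<close> and vanishing tails: it lies in the domain of the adjoint
  but not in that of \<open>S\<close>, and it is mapped to half of itself, which also refutes skewness.
\<close>

section \<open>Series and unit vectors\<close>

lemma tendsto_zero_of_square_summable:
  assumes "square_summable x"
  shows "x \<longlonglongrightarrow> 0"
  using summable_LIMSEQ_zero [OF assms [unfolded square_summable_def]] by simp

lemma tail_sums_of_difference:
  fixes x t :: "nat \<Rightarrow> real"
  assumes step: "\<And>n. t n - t (Suc n) = x (Suc n)" and lim: "t \<longlonglongrightarrow> 0"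
  shows "(\<lambda>i. x (i + Suc n)) sums t n"
proof -
  have "(\<lambda>i. t (i + n)) \<longlonglongrightarrow> 0"
    using lim by (rule LIMSEQ_ignore_initial_segment)
  from telescope_sums' [OF this] show ?thesis
    using step by simp
qed

lemma tails_tendsto_zero:
  fixes x :: "nat \<Rightarrow> real"
  assumes "summable x"
  shows "(\<lambda>n. \<Sum>i. x (i + n)) \<longlonglongrightarrow> 0"
proof -
  have "(\<lambda>n. suminf x - (\<Sum>i<n. x i)) \<longlonglongrightarrow> suminf x - suminf x"
    by (intro tendsto_intros summable_LIMSEQ assms)
  then show ?thesis
    by (simp add: suminf_minus_initial_segment [OF assms])
qed

lemma tail_Suc:
  fixes x :: "nat \<Rightarrow> real"
  assumes "summable x"
  shows "(\<Sum>i. x (i + n)) = x n + (\<Sum>i. x (i + Suc n))"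
  by (simp add: suminf_minus_initial_segment [OF assms] del: add_Suc_right)

lift_definition unit_ell2 :: "nat \<Rightarrow> ell2" is "\<lambda>n m. if m = n then 1 else 0"
  unfolding square_summable_def by (rule summable_finite [of "{n}" for n]) auto

lemma coord_unit_sums: "coord (unit_ell2 n) sums 1"
  unfolding unit_ell2.rep_eq using sums_single [of n "\<lambda>_. 1::real"] by simp

lemma sum_coord_unit: "(\<Sum>i<k. coord (unit_ell2 n) i) = (if n < k then 1 else 0)"
  by (simp add: unit_ell2.rep_eq)

lemma inner_unit: "unit_ell2 n \<bullet> x = coord x n"
proof -
  have "(\<lambda>m. coord (unit_ell2 n) m * coord x m) = (\<lambda>m. if m = n then coord x m else 0)"
    by (auto simp: unit_ell2.rep_eq)
  then show ?thesis
    by (simp add: inner_ell2_def sums_unique [OF sums_single, symmetric])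
qed

section \<open>The graph of the adjoint\<close>

lemma adjoint_relation_iff:
  "(x, x') \<in> adjoint_relation A \<longleftrightarrow> (\<forall>(a, a') \<in> A. a \<bullet> x' = a' \<bullet> x)"
  by (auto simp: adjoint_relation_def orthogonal_comp_def orthogonal_def)

text \<open>
  The partial sums of \<open>e\<^sub>n - e\<^bsub>n+1\<^esub>\<close> form the vector \<open>e\<^sub>n\<close>, which is why
  the difference lies in the domain and has a finitely supported image.
\<close>

lemma unit_difference_in_S:
  "(unit_ell2 n - unit_ell2 (Suc n), (1/2) *\<^sub>R (unit_ell2 n + unit_ell2 (Suc n))) \<in> S"
proof -
  let ?a = "unit_ell2 n - unit_ell2 (Suc n)"
  have heads: "(\<Sum>i<k. coord ?a i) = (if k = Suc n then 1 else 0)" for k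
    by (auto simp: coord_diff sum_subtractf sum_coord_unit)
  have "coord ?a sums 0"
    using sums_diff [OF coord_unit_sums [of n] coord_unit_sums [of "Suc n"]]
    by (simp add: minus_ell2.rep_eq)
  moreover have "(\<lambda>k. \<Sum>i\<le>k. coord ?a i) = coord (unit_ell2 n)"
    unfolding lessThan_Suc_atMost [symmetric] heads by (simp add: unit_ell2.rep_eq fun_eq_iff)
  then have "square_summable (\<lambda>k. \<Sum>i\<le>k. coord ?a i)"
    using square_summable_coord by metis
  ultimately have "?a \<in> dom_S"
    by (simp add: dom_S_def)
  then show ?thesis
    unfolding S_def
    by (simp add: heads) (simp add: coord_diff scaleR_ell2.rep_eq plus_ell2.rep_eq unit_ell2.rep_eq)
qed

text \<open>
  The inclusion that rests on the test vectors \<open>e\<^sub>n - e\<^bsub>n+1\<^esub>\<close>: they determine the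
  differences of \<open>x'\<^sub>n - x\<^sub>n / 2\<close>, and square-summability fixes the remaining constant.
\<close>

lemma adjoint_S_tail_sums:
  assumes "(x, x') \<in> adjoint_relation S"
  shows "(\<lambda>i. coord x (i + Suc n)) sums (coord x' n - coord x n / 2)"
proof (rule tail_sums_of_difference)
  fix n
  have "(unit_ell2 n - unit_ell2 (Suc n)) \<bullet> x'
      = ((1/2) *\<^sub>R (unit_ell2 n + unit_ell2 (Suc n))) \<bullet> x"
    using assms unit_difference_in_S [of n] unfolding adjoint_relation_iff by blast
  then have "coord x' n - coord x' (Suc n) = (coord x n + coord x (Suc n)) / 2"
    by (simp add: inner_diff_left inner_add_left inner_unit)
  then show "coord x' n - coord x n / 2 - (coord x' (Suc n) - coord x (Suc n) / 2)
      = coord x (Suc n)"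
    by (simp add: field_simps)
next
  show "(\<lambda>n. coord x' n - coord x n / 2) \<longlonglongrightarrow> 0"
    using tendsto_diff [OF tendsto_zero_of_square_summable [OF square_summable_coord [of x']]
        tendsto_divide [OF tendsto_zero_of_square_summable [OF square_summable_coord [of x]]
          tendsto_const [of 2]]]
    by simp
qed

text \<open>
  The converse inclusion, by summation by parts. In terms of heads \<open>p\<close> and tails \<open>r\<close> the four
  sequences involved are \<open>a\<^sub>n = p\<^bsub>n+1\<^esub> - p\<^sub>n\<close>, \<open>(S a)\<^sub>n = (p\<^bsub>n+1\<^esub> + p\<^sub>n) / 2\<close>,
  \<open>x\<^sub>n = r\<^sub>n - r\<^bsub>n+1\<^esub>\<close> and \<open>x'\<^sub>n = (r\<^sub>n + r\<^bsub>n+1\<^esub>) / 2\<close>, whence the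
  telescoping.
\<close>

lemma inner_S_eq:
  assumes S: "(a, a') \<in> S"
    and x: "summable (coord x)"
    and x': "\<And>n. coord x' n = (\<Sum>i. coord x (i + Suc n)) + coord x n / 2"
  shows "a \<bullet> x' = a' \<bullet> x"
proof -
  define p where "p n = (\<Sum>i<n. coord a i)" for n
  define r where "r n = (\<Sum>i. coord x (i + n))" for n
  have p: "p \<longlonglongrightarrow> 0"
    using S by (simp add: S_def dom_S_def sums_def p_def [abs_def])
  have r: "r \<longlonglongrightarrow> 0"
    unfolding r_def [abs_def] by (rule tails_tendsto_zero [OF x])
  have a: "coord a n = p (Suc n) - p n" for n
    by (simp add: p_def)
  have a': "coord a' n = (p (Suc n) + p n) / 2" for n
    using S by (simp add: S_def p_def field_simps)
  have xr: "coord x n = r n - r (Suc n)" for n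
    unfolding r_def using tail_Suc [OF x, of n] by simp
  have xr': "coord x' n = (r n + r (Suc n)) / 2" for n
    using x' [of n] xr [of n] by (simp only: r_def [of "Suc n", symmetric]) (simp add: field_simps)
  have term_eq: "coord a n * coord x' n - coord a' n * coord x n
      = p (Suc n) * r (Suc n) - p n * r n" for n
    unfolding a a' xr xr' by (simp add: field_simps)
  have "(\<lambda>n. p n * r n) \<longlonglongrightarrow> 0"
    using tendsto_mult [OF p r] by simp
  from telescope_sums [OF this]
  have telescoped: "(\<lambda>n. coord a n * coord x' n - coord a' n * coord x n) sums 0"
    by (simp add: term_eq p_def)
  have s: "(\<lambda>n. coord u n * coord v n) sums (u \<bullet> v)" for u v
    unfolding inner_ell2_def
    by (intro summable_sums square_summable_mult square_summable_coord)
  show ?thesis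
    using sums_unique2 [OF sums_diff [OF s [of a x'] s [of a' x]] telescoped] by simp
qed

lemma adjoint_S_iff:
  "(x, x') \<in> adjoint_relation S \<longleftrightarrow>
    summable (coord x) \<and> (\<forall>n. coord x' n = (\<Sum>i. coord x (i + Suc n)) + coord x n / 2)"
proof
  assume *: "(x, x') \<in> adjoint_relation S"
  have "summable (coord x)"
    using sums_summable [OF adjoint_S_tail_sums [OF *, of 0]]
    by (simp only: summable_iff_shift)
  moreover have "coord x' n = (\<Sum>i. coord x (i + Suc n)) + coord x n / 2" for n
    using sums_unique [OF adjoint_S_tail_sums [OF *, of n]] by simp
  ultimately show "summable (coord x) \<and>
      (\<forall>n. coord x' n = (\<Sum>i. coord x (i + Suc n)) + coord x n / 2)"
    by blast
next
  assume "summable (coord x) \<and>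
    (\<forall>n. coord x' n = (\<Sum>i. coord x (i + Suc n)) + coord x n / 2)"
  then show "(x, x') \<in> adjoint_relation S"
    unfolding adjoint_relation_iff using inner_S_eq by blast
qed

section \<open>Domain, values and matrix of the adjoint\<close>

lemma single_valued_adjoint_S: "single_valued (adjoint_relation S)"
  by (auto simp: single_valued_def adjoint_S_iff intro!: ell2_eqI)

text \<open>
  Since \<open>x\<close> is itself square-summable, the sequence \<open>\<Sum>\<^bsub>i>n\<^esub> x\<^sub>i + x\<^sub>n / 2\<close> is
  square-summable, hence a possible value of the adjoint, exactly when the tails are.
\<close>

lemma Domain_adjoint_S:
  "Domain (adjoint_relation S) =
    {y. summable (coord y) \<and> square_summable (\<lambda>n. \<Sum>i. coord y (i + Suc n))}"
proof (intro set_eqI iffI)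
  fix y assume "y \<in> Domain (adjoint_relation S)"
  then obtain z where y: "summable (coord y)"
    and z: "\<And>n. coord z n = (\<Sum>i. coord y (i + Suc n)) + coord y n / 2"
    unfolding adjoint_S_iff Domain_iff by blast
  have "square_summable (\<lambda>n. coord z n + (- 1 / 2) * coord y n)"
    by (intro square_summable_add square_summable_scale square_summable_coord)
  then show "y \<in> {y. summable (coord y) \<and> square_summable (\<lambda>n. \<Sum>i. coord y (i + Suc n))}"
    using y by (simp add: z)
next
  fix y assume y: "y \<in> {y. summable (coord y) \<and> square_summable (\<lambda>n. \<Sum>i. coord y (i + Suc n))}"
  then have "square_summable (\<lambda>n. (\<Sum>i. coord y (i + Suc n)) + (1 / 2) * coord y n)"
    by (intro square_summable_add square_summable_scale square_summable_coord) simp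
  then have "(y, Abs_ell2 (\<lambda>n. (\<Sum>i. coord y (i + Suc n)) + coord y n / 2))
      \<in> adjoint_relation S"
    using y by (simp add: adjoint_S_iff Abs_ell2_inverse)
  then show "y \<in> Domain (adjoint_relation S)" by blast
qed

lemma adjoint_S_matrix:
  assumes "(y, z) \<in> adjoint_relation S"
  shows "(\<lambda>m. (if m = n then 1 / 2 else if n < m then 1 else 0) * coord y m) sums coord z n"
    (is "?f sums _")
proof -
  have "(\<Sum>i<Suc n. ?f i) = coord y n / 2"
    by simp
  moreover have "(\<lambda>i. ?f (i + Suc n)) = (\<lambda>i. coord y (i + Suc n))"
    by auto
  ultimately have "(\<lambda>i. ?f (i + Suc n)) sums (coord z n - (\<Sum>i<Suc n. ?f i))"
    using adjoint_S_tail_sums [OF assms, of n] by simp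
  then show ?thesis
    using sums_iff_shift' [of ?f "Suc n" "coord z n"] by blast
qed

section \<open>Comparison with the operator\<close>

lemma S_imp_uminus_adjoint_S:
  assumes "(y, z) \<in> S"
  shows "(y, - z) \<in> adjoint_relation S"
proof -
  have y: "coord y sums 0" and z: "\<And>n. coord z n = (\<Sum>i<n. coord y i) + coord y n / 2"
    using assms by (auto simp: S_def dom_S_def)
  \<comment> \<open>The total is zero, so each tail is the negative of the complementary head.\<close>
  have "(\<Sum>i. coord y (i + Suc n)) = - (\<Sum>i<Suc n. coord y i)" for n
    using suminf_minus_initial_segment [OF sums_summable [OF y], of "Suc n"]
    by (simp only: sums_unique [OF y, symmetric])
  then show ?thesis
    using sums_summable [OF y] by (simp add: adjoint_S_iff uminus_ell2.rep_eq z)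
qed

lemma adjoint_S_unit_0: "(unit_ell2 0, (1/2) *\<^sub>R unit_ell2 0) \<in> adjoint_relation S"
  using sums_summable [OF coord_unit_sums [of 0]]
  by (simp add: adjoint_S_iff scaleR_ell2.rep_eq unit_ell2.rep_eq)

lemma unit_not_in_dom_S: "unit_ell2 n \<notin> dom_S"
  using sums_unique2 [OF coord_unit_sums [of n], of 0] by (auto simp: dom_S_def)

theorem proposition3p6:
  shows "single_valued (adjoint_relation S) \<and>
    Domain (adjoint_relation S) =
      {y. summable (coord y) \<and> square_summable (\<lambda>n. \<Sum>i. coord y (i + Suc n))} \<and>
    (\<forall>(y, z) \<in> adjoint_relation S. \<forall>n.
      coord z n = (\<Sum>i. coord y (i + Suc n)) + coord y n / 2) \<and>
    (\<forall>(y, z) \<in> adjoint_relation S. \<forall>n.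
      (\<lambda>m. (if m = n then 1 / 2 else if n < m then 1 else 0) * coord y m) sums coord z n) \<and>
    Domain S \<subset> Domain (adjoint_relation S) \<and>
    (\<forall>(y, z) \<in> S. adjoint_relation S `` {y} = {- z}) \<and>
    \<not> skew_relation (adjoint_relation S)"
proof (intro conjI)
  show "\<forall>(y, z) \<in> adjoint_relation S. \<forall>n.
      coord z n = (\<Sum>i. coord y (i + Suc n)) + coord y n / 2"
    using adjoint_S_iff by blast
  show "\<forall>(y, z) \<in> adjoint_relation S. \<forall>n.
      (\<lambda>m. (if m = n then 1 / 2 else if n < m then 1 else 0) * coord y m) sums coord z n"
    using adjoint_S_matrix by blast
  show "Domain S \<subset> Domain (adjoint_relation S)"
  proof
    show "Domain S \<subseteq> Domain (adjoint_relation S)"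
      using S_imp_uminus_adjoint_S by blast
    show "Domain S \<noteq> Domain (adjoint_relation S)"
      using adjoint_S_unit_0 unit_not_in_dom_S [of 0] Domain_S by blast
  qed
  show "\<forall>(y, z) \<in> S. adjoint_relation S `` {y} = {- z}"
    using S_imp_uminus_adjoint_S single_valued_adjoint_S
    by (fastforce dest: single_valuedD)
  have "unit_ell2 0 \<bullet> ((1/2) *\<^sub>R unit_ell2 0) \<noteq> 0"
    by (simp add: inner_unit unit_ell2.rep_eq)
  then show "\<not> skew_relation (adjoint_relation S)"
    using adjoint_S_unit_0 unfolding skew_relation_def by blast
qed (rule single_valued_adjoint_S, rule Domain_adjoint_S)

end
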